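(* Let $\mathscr{H}=\mathbb{C}^n$ and $\mathscr{K}=\mathbb{C}^m$ with their standard orthonormal bases, let $\tau$ be a state on $\mathscr{H}\otimes\mathscr{K}$ such that $\mathrm{proj}(\tau)$ is invertible, and let $p$ be a predicate on $\mathscr{H}$ and $q$ a predicate on $\mathscr{K}$ such that the conditionings below are defined (the relevant validities are non-zero). Then \[ \mathsf{M}_2\big(\tau|_{p\otimes \mathrm{id}}\big) = \mathrm{extr}(\tau)\gg\big(\mathrm{proj}(\tau)|^{p^{T}}\big) \qquad\text{and}\qquad \mathsf{M}_1\big(\tau|_{\mathrm{id}\otimes q}\big) = \big(\mathrm{proj}(\tau)|^{\mathrm{extr}(\tau)\ll q}\big)^{T}. \]
   Context: States are positive operators of trace one; predicates are operators $r$ with $0\le r\le \mathrm{id}$; validity $\sigma\models r=\mathrm{tr}(\sigma r)$. Lower conditioning: $\sigma|_{r}=\frac{\sqrt{r}\,\sigma\sqrt{r}}{\sigma\models r}$; upper conditioning: $\sigma|^{r}=\frac{\sqrt{\sigma}\,r\sqrt{\sigma}}{\sigma\models r}$ (positive square roots, defined when $\sigma\models r\neq0$). $A^T$ is the transpose and $\overline{z}$ complex conjugation, w.r.t. the standard bases. Write $|ik\rangle=|i\rangle\otimes|k\rangle$. Marginals (partial traces): $\langle i|\mathsf{M}_1(\tau)|j\rangle=\sum_k\langle ik|\tau|jk\rangle$ and $\langle k|\mathsf{M}_2(\tau)|\ell\rangle=\sum_i\langle ik|\tau|i\ell\rangle$. Define $\mathrm{proj}(\tau)=\mathsf{M}_1(\tau)^T$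 (an $n\times n$ matrix). The extracted channel $\mathrm{extr}(\tau)$ is the family of $n\times n$ matrices, indexed by $1\le k,\ell\le m$, \[ \mathrm{extr}(\tau)_{k\ell}=\sum_{i,j}\overline{\langle ik|\tau|j\ell\rangle}\;\sqrt{\mathrm{proj}(\tau)^{-1}}\,|i\rangle\langle j|\,\sqrt{\mathrm{proj}(\tau)^{-1}}. \] For such a family $c=(c_{k\ell})$ of $n\times n$ matrices (representing a linear map $\mathcal{B}(\mathscr{K})\to\mathcal{B}(\mathscr{H})$, $|k\rangle\langle\ell|\mapsto c_{k\ell}$), predicate transformation of an $m\times m$ matrix $q$ is $c\ll q=\sum_{k,\ell}q_{k\ell}\,c_{k\ell}$ (an $n\times n$ matrix), and state transformation of an $n\times n$ matrix $\sigma$ is the $m\times m$ matrix $(c\gg\sigma)_{k\ell}=\mathrm{tr}(c_{\ell k}\,\sigma)$. *)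

theory Defs
  imports "HOL-Analysis.Analysis"
begin

(* Operators on C^n are matrices complex^'n^'n with A $ i $ j = <i|A|j>, where n = CARD('n).
   The space C^n (x) C^m is indexed by 'n \<times> 'm, so that the index (i, k) stands for |ik>. *)

definition cinner :: "complex^'n \<Rightarrow> complex^'n \<Rightarrow> complex" where
  "cinner x y = (\<Sum>i\<in>UNIV. cnj (x $ i) * y $ i)"

definition positive_op :: "complex^'n^'n \<Rightarrow> bool" where
  "positive_op A \<longleftrightarrow> (\<forall>x. cinner x (A *v x) \<in> \<real>\<^sub>\<ge>\<^sub>0)"

definition loewner_le :: "complex^'n^'n \<Rightarrow> complex^'n^'n \<Rightarrow> bool" where
  "loewner_le A B \<longleftrightarrow> positive_op (B - A)"

definition is_state :: "complex^'n^'n \<Rightarrow> bool" where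
  "is_state \<sigma> \<longleftrightarrow> positive_op \<sigma> \<and> trace \<sigma> = 1"

definition is_predicate :: "complex^'n^'n \<Rightarrow> bool" where
  "is_predicate r \<longleftrightarrow> loewner_le 0 r \<and> loewner_le r (mat 1)"

(* The positive square root; only meaningful for positive arguments. *)
definition op_sqrt :: "complex^'n^'n \<Rightarrow> complex^'n^'n" where
  "op_sqrt A = (THE B. positive_op B \<and> B ** B = A)"

(* The library's *s on complex^'n^'m would take a vector as its scalar. *)
definition mscale :: "complex \<Rightarrow> complex^'n^'m \<Rightarrow> complex^'n^'m" where
  "mscale z A = (\<chi> i j. z * A $ i $ j)"

definition validity :: "complex^'n^'n \<Rightarrow> complex^'n^'n \<Rightarrow> complex" where
  "validity \<sigma> r = trace (\<sigma> ** r)"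

definition lower_cond :: "complex^'n^'n \<Rightarrow> complex^'n^'n \<Rightarrow> complex^'n^'n" where
  "lower_cond \<sigma> r = mscale (1 / validity \<sigma> r) (op_sqrt r ** \<sigma> ** op_sqrt r)"

definition upper_cond :: "complex^'n^'n \<Rightarrow> complex^'n^'n \<Rightarrow> complex^'n^'n" where
  "upper_cond \<sigma> r = mscale (1 / validity \<sigma> r) (op_sqrt \<sigma> ** r ** op_sqrt \<sigma>)"

definition tensor_op ::
    "complex^'n^'n \<Rightarrow> complex^'m^'m \<Rightarrow> complex^('n \<times> 'm)^('n \<times> 'm)" where
  "tensor_op A B = (\<chi> r s. A $ fst r $ fst s * B $ snd r $ snd s)"

definition marg1 :: "complex^('n::finite \<times> 'm::finite)^('n \<times> 'm) \<Rightarrow> complex^'n^'n" where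
  "marg1 \<tau> = (\<chi> i j. \<Sum>k\<in>UNIV. \<tau> $ (i, k) $ (j, k))"

definition marg2 :: "complex^('n::finite \<times> 'm::finite)^('n \<times> 'm) \<Rightarrow> complex^'m^'m" where
  "marg2 \<tau> = (\<chi> k l. \<Sum>i\<in>UNIV. \<tau> $ (i, k) $ (i, l))"

definition proj :: "complex^('n::finite \<times> 'm::finite)^('n \<times> 'm) \<Rightarrow> complex^'n^'n" where
  "proj \<tau> = transpose (marg1 \<tau>)"

definition ketbra :: "'n \<Rightarrow> 'n \<Rightarrow> complex^'n^'n" where
  "ketbra i j = (\<chi> a b. if a = i \<and> b = j then 1 else 0)"

(* A family c of n-by-n matrices c k l stands for the linear map B(C^m) \<rightarrow> B(C^n)
   sending |k><l| to c k l. *)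

definition extr ::
    "complex^('n::finite \<times> 'm::finite)^('n \<times> 'm) \<Rightarrow> 'm \<Rightarrow> 'm \<Rightarrow> complex^'n^'n" where
  "extr \<tau> k l = (\<Sum>i\<in>UNIV. \<Sum>j\<in>UNIV. mscale (cnj (\<tau> $ (i, k) $ (j, l)))
     (op_sqrt (matrix_inv (proj \<tau>)) ** ketbra i j ** op_sqrt (matrix_inv (proj \<tau>))))"

definition pred_trans ::
    "('m \<Rightarrow> 'm \<Rightarrow> complex^'n^'n) \<Rightarrow> complex^'m^'m \<Rightarrow> complex^'n^'n" where
  "pred_trans c q = (\<Sum>k\<in>UNIV. \<Sum>l\<in>UNIV. mscale (q $ k $ l) (c k l))"

definition state_trans ::
    "('m \<Rightarrow> 'm \<Rightarrow> complex^'n^'n) \<Rightarrow> complex^'n^'n \<Rightarrow> complex^'m^'m" where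
  "state_trans c \<sigma> = (\<chi> k l. trace (c l k ** \<sigma>))"

end

theory Submission
  imports Defs
begin

text \<open>
  Write \<open>R = proj \<tau>\<close> and let \<open>T\<^sub>k\<^sub>l\<close> have entries \<open>cnj \<langle>ik|\<tau>|jl\<rangle>\<close>, so that
  \<open>extr(\<tau>)\<^sub>k\<^sub>l = \<surd>(R\<inverse>) T\<^sub>k\<^sub>l \<surd>(R\<inverse>)\<close>. The square roots \<open>\<surd>R\<close> of the upper conditionings cancel those
  of the extracted channel because \<open>\<surd>(R\<inverse>) = (\<surd>R)\<inverse>\<close>, while \<open>\<surd>(p \<otimes> id) = \<surd>p \<otimes> id\<close> lets the two halves of
  \<open>p\<close> recombine cyclically under the partial trace; both sides become the same contraction of \<open>\<tau>\<close>
  with \<open>p\<close> (respectively \<open>q\<close>). Both facts on roots follow from existence and uniqueness of the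
  positive square root.
\<close>

section \<open>The Hermitian form on vectors and elementary matrix identities\<close>

lemma cinner_add_left: "cinner (x + y) z = cinner x z + cinner y z"
  by (simp add: cinner_def algebra_simps sum.distrib)

lemma cinner_add_right: "cinner x (y + z) = cinner x y + cinner x z"
  by (simp add: cinner_def algebra_simps sum.distrib)

lemma cinner_diff_left: "cinner (x - y) z = cinner x z - cinner y z"
  by (simp add: cinner_def algebra_simps sum_subtractf)

lemma cinner_diff_right: "cinner x (y - z) = cinner x y - cinner x z"
  by (simp add: cinner_def algebra_simps sum_subtractf)

lemma cinner_scale_left: "cinner (c *s x) y = cnj c * cinner x y"
  by (simp add: cinner_def sum_distrib_left mult.assoc)

lemma cinner_scale_right: "cinner x (c *s y) = c * cinner x y"
  by (simp add: cinner_def sum_distrib_left algebra_simps)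

lemma cinner_zero_left [simp]: "cinner 0 x = 0"
  by (simp add: cinner_def)

lemma cinner_zero_right [simp]: "cinner x 0 = 0"
  by (simp add: cinner_def)

lemmas cinner_simps = cinner_add_left cinner_add_right cinner_diff_left cinner_diff_right
  cinner_scale_left cinner_scale_right

lemma cnj_cinner: "cnj (cinner x y) = cinner y x"
  by (simp add: cinner_def mult.commute)

lemma cinner_self: "cinner x x = of_real ((norm x)\<^sup>2)"
proof -
  have "cinner x x = of_real (\<Sum>i\<in>UNIV. (norm (x $ i))\<^sup>2)"
    unfolding cinner_def of_real_sum
    by (intro sum.cong refl) (metis complex_norm_square mult.commute)
  also have "(\<Sum>i\<in>UNIV. (norm (x $ i))\<^sup>2) = (norm x)\<^sup>2"
    by (simp add: norm_vec_def L2_set_def sum_nonneg)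
  finally show ?thesis .
qed

lemma cinner_matrix: "cinner x (A *v y) = (\<Sum>i\<in>UNIV. \<Sum>j\<in>UNIV. cnj (x $ i) * A $ i $ j * y $ j)"
  by (simp add: cinner_def matrix_vector_mult_def sum_distrib_left mult.assoc)

lemma cinner_axis_matrix: "cinner (axis i 1) (A *v axis j 1) = A $ i $ j"
proof -
  have "cinner (axis i 1) y = y $ i" for y
    by (simp add: cinner_def axis_def if_distrib if_distribR cong: if_cong)
  then show ?thesis
    by (simp add: matrix_vector_mult_def axis_def if_distrib cong: if_cong)
qed

lemma matrix_diff_ldistrib:
  fixes A :: "'a::ring_1^'n^'m"
  shows "A ** (B - C) = A ** B - A ** C"
  by (simp add: vec_eq_iff matrix_matrix_mult_def right_diff_distrib sum_subtractf)

lemma matrix_diff_rdistrib: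
  fixes A :: "'a::ring_1^'n^'m"
  shows "(A - B) ** C = A ** C - B ** C"
  by (simp add: vec_eq_iff matrix_matrix_mult_def left_diff_distrib sum_subtractf)

lemma
  assumes "invertible A"
  shows matrix_inv_right: "A ** matrix_inv A = mat 1"
    and matrix_inv_left: "matrix_inv A ** A = mat 1"
  using someI_ex[OF assms[unfolded invertible_def]] by (simp_all add: matrix_inv_def)

section \<open>Positive operators: self-adjointness, kernels and closure properties\<close>

lemma positive_op_iff:
  "positive_op A \<longleftrightarrow> (\<forall>x. 0 \<le> Re (cinner x (A *v x)) \<and> Im (cinner x (A *v x)) = 0)"
  by (simp add: positive_op_def complex_nonneg_Reals_iff)

lemma positive_op_form_eq:
  assumes "positive_op A"
  shows "cinner x (A *v x) = of_real (Re (cinner x (A *v x)))"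
  using assms by (simp add: positive_op_iff complex_eq_iff)

text \<open>Over the complex numbers a real quadratic form already forces the operator to be
  self-adjoint, by polarization along \<open>x + y\<close> and \<open>x + \<i>y\<close>.\<close>

lemma positive_op_adjoint:
  assumes "positive_op A"
  shows "cinner x (A *v y) = cinner (A *v x) y"
proof -
  have im: "Im (cinner z (A *v z)) = 0" for z
    using assms by (simp add: positive_op_iff)
  have "Im (cinner x (A *v y) + cinner y (A *v x)) = 0"
    using im[of "x + y"] im[of x] im[of y]
    by (simp add: matrix_vector_right_distrib cinner_simps)
  moreover have "Re (cinner x (A *v y)) = Re (cinner y (A *v x))"
    using im[of "x + \<i> *s y"] im[of x] im[of y]
    by (simp add: matrix_vector_right_distrib vector_scalar_commute cinner_simps)
  ultimately have "cinner x (A *v y) = cnj (cinner y (A *v x))"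
    by (simp add: complex_eq_iff)
  then show ?thesis by (simp add: cnj_cinner)
qed

lemma positive_op_cnj_entry:
  assumes "positive_op A"
  shows "cnj (A $ i $ j) = A $ j $ i"
proof -
  have "A $ j $ i = cinner (A *v axis j 1) (axis i 1)"
    using positive_op_adjoint[OF assms] by (simp flip: cinner_axis_matrix)
  also have "\<dots> = cnj (A $ i $ j)"
    by (simp add: cnj_cinner flip: cinner_axis_matrix)
  finally show ?thesis by simp
qed

text \<open>A positive form attains its minimum 0 at \<open>v\<close>. If \<open>A *v v\<close> were
  non-zero, a small step from \<open>v\<close> against that direction would make the form
  negative.\<close>

lemma positive_op_form_zero:
  assumes "positive_op A" and "cinner v (A *v v) = 0"
  shows "A *v v = 0"
proof (rule ccontr)
  define w N M where "w = A *v v" and "N = (norm w)\<^sup>2" and "M = Re (cinner w (A *v w))"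
  assume "A *v v \<noteq> 0"
  then have N: "N > 0" by (simp add: N_def w_def)
  have M: "M \<ge> 0" using assms(1) by (simp add: M_def positive_op_iff)
  have vw: "cinner v (A *v w) = of_real N"
    using positive_op_adjoint[OF assms(1)] by (simp add: N_def cinner_self flip: w_def)
  have key: "2 * s * N \<le> s\<^sup>2 * M" for s :: real
  proof -
    have "0 \<le> Re (cinner (v - of_real s *s w) (A *v (v - of_real s *s w)))"
      using assms(1) by (simp add: positive_op_iff)
    also have "A *v (v - of_real s *s w) = w - of_real s *s (A *v w)"
      by (simp add: matrix_vector_mult_diff_distrib vector_scalar_commute w_def)
    also have "cinner (v - of_real s *s w) (w - of_real s *s (A *v w))
        = - of_real (2 * s * N) + of_real (s\<^sup>2) * cinner w (A *v w)"
      using assms(2) by (simp add: cinner_simps vw cinner_self power2_eq_square N_def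
          flip: w_def) (simp add: algebra_simps)
    finally show ?thesis by (simp add: M_def)
  qed
  \<comment> \<open>This step size gives \<open>s * M < N\<close>, contradicting \<open>key\<close>;
    the summand 1 keeps the denominator positive even when \<open>M = 0\<close>.\<close>
  define s where "s = N / (M + 1)"
  have s: "s > 0" and sM: "s * (M + 1) = N" using N M by (simp_all add: s_def)
  have "s * (2 * N) \<le> s * (s * M)" using key[of s] by (simp add: power2_eq_square mult_ac)
  then have "2 * N \<le> s * M" using s by simp
  also have "s * M = N - s" using sM by (simp add: algebra_simps)
  finally show False using N s by simp
qed

lemma positive_op_eq_zero:
  assumes "positive_op A" and "\<And>x. cinner x (A *v x) = 0"
  shows "A = 0"
  using positive_op_form_zero[OF assms(1)] assms(2) by (simp add: matrix_eq)

lemma positive_op_zero: "positive_op 0"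
  by (simp add: positive_op_iff)

lemma positive_op_mat_1: "positive_op (mat 1)"
  by (simp add: positive_op_iff cinner_self)

text \<open>For self-adjoint \<open>A\<close> the form of \<open>A ** A\<close> at \<open>x\<close>
  is the squared norm of \<open>A *v x\<close>.\<close>

lemma positive_op_square:
  assumes "\<And>i j. cnj (A $ i $ j) = A $ j $ i"
  shows "positive_op (A ** A)"
proof -
  have "cinner x ((A ** A) *v x) = cinner (A *v x) (A *v x)" for x
  proof -
    have "cinner x (A *v y) = cinner (A *v x) y" for y
    proof -
      have "cinner x (A *v y) = (\<Sum>i\<in>UNIV. \<Sum>j\<in>UNIV. cnj (A $ j $ i * x $ i) * y $ j)"
        by (simp add: cinner_matrix assms mult.commute)
      also have "\<dots> = cinner (A *v x) y"
        by (subst sum.swap) (simp add: cinner_def matrix_vector_mult_def sum_distrib_right)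
      finally show ?thesis .
    qed
    then show ?thesis by (simp flip: matrix_vector_mul_assoc)
  qed
  then show ?thesis by (simp add: positive_op_iff cinner_self)
qed

text \<open>Transposing the matrix amounts to evaluating the form at the entrywise conjugate
  vector.\<close>

lemma positive_op_transpose:
  assumes "positive_op A"
  shows "positive_op (transpose A)"
proof -
  have "cinner x (transpose A *v x) = cinner (\<chi> i. cnj (x $ i)) (A *v (\<chi> i. cnj (x $ i)))" for x
    unfolding cinner_matrix by (subst sum.swap) (simp add: transpose_def mult_ac)
  then show ?thesis using assms by (simp add: positive_op_def)
qed

lemma positive_op_right_inverse:
  assumes "positive_op A" and "A ** B = mat 1"
  shows "positive_op B"
proof -
  have "cinner x (B *v x) = cinner (B *v x) (A *v (B *v x))" for x
  proof -
    have "A *v (B *v x) = x" by (simp add: matrix_vector_mul_assoc assms)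
    then show ?thesis using positive_op_adjoint[OF assms(1), of "B *v x" "B *v x"] by simp
  qed
  then show ?thesis using assms(1) by (simp add: positive_op_def)
qed

section \<open>Existence of square roots\<close>

definition rank_one :: "complex^'n \<Rightarrow> complex^'n^'n" where
  "rank_one v = (\<chi> i j. v $ i * cnj (v $ j))"

lemma rank_one_mult_vec: "rank_one v *v x = cinner v x *s v"
  by (simp add: vec_eq_iff rank_one_def matrix_vector_mult_def cinner_def sum_distrib_right
      sum_distrib_left mult_ac)

lemma mscale_mult_vec: "mscale c A *v x = c *s (A *v x)"
  by (simp add: vec_eq_iff mscale_def matrix_vector_mult_def sum_distrib_left mult_ac)

text \<open>The form attains a maximum on the compact unit sphere, and a maximizer is an eigenvector
  whose eigenvalue is the maximum.\<close>

lemma positive_op_top_eigenvector: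
  fixes A :: "complex^'n^'n"
  assumes "positive_op A" and "A \<noteq> 0"
  obtains v and r :: real where "cinner v v = 1" and "r > 0" and "A *v v = of_real r *s v"
proof -
  define f where "f x = Re (cinner x (A *v x))" for x
  have "continuous_on (sphere 0 1) f"
    unfolding f_def cinner_matrix by (intro continuous_intros)
  moreover have "sphere (0 :: complex^'n) 1 \<noteq> {}" by simp
  ultimately obtain v where v: "norm v = 1" and max: "\<And>x. norm x = 1 \<Longrightarrow> f x \<le> f v"
    using continuous_attains_sup[OF compact_sphere, of 0 1 f] by auto
  have vv: "cinner v v = 1" by (simp add: cinner_self v)
  have le: "f x \<le> f v * (norm x)\<^sup>2" for x
  proof (cases "x = 0")
    case True
    then show ?thesis by (simp add: f_def)
  next
    case False
    define y where "y = of_real (1 / norm x) *s x"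
    have xy: "x = of_real (norm x) *s y" using False by (simp add: y_def)
    have "cinner y y = of_real (1 / norm x) * (of_real (1 / norm x) * of_real ((norm x)\<^sup>2))"
      unfolding y_def cinner_scale_left cinner_scale_right by (simp add: cinner_self)
    then have "cinner y y = 1" using False by (simp add: power2_eq_square)
    then have "(norm y)\<^sup>2 = 1" unfolding cinner_self by (simp only: of_real_eq_1_iff)
    then have "norm y = 1"
      using norm_ge_zero[of y] by (auto simp: power2_eq_1_iff simp del: norm_ge_zero)
    then have "f y \<le> f v" by (rule max)
    moreover have "f x = (norm x)\<^sup>2 * f y"
      by (subst xy) (simp add: f_def vector_scalar_commute cinner_simps power2_eq_square)
    ultimately show ?thesis by (simp add: mult.commute mult_right_mono)
  qed
  \<comment> \<open>By \<open>le\<close> this operator is positive. Its form vanishes at the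
    maximizer \<open>v\<close>, so \<open>v\<close> lies in its kernel, which is the eigenvalue
    equation.\<close>
  define P where "P = mscale (of_real (f v)) (mat 1) - A"
  have Px: "P *v x = of_real (f v) *s x - A *v x" for x
    by (simp add: P_def matrix_vector_mult_diff_rdistrib mscale_mult_vec)
  have "positive_op P"
    using le assms(1) by (auto simp: positive_op_iff Px cinner_simps cinner_self f_def)
  moreover have "cinner v (P *v v) = 0"
    using positive_op_form_eq[OF assms(1), of v] by (simp add: Px cinner_simps vv f_def)
  ultimately have "P *v v = 0" by (rule positive_op_form_zero)
  then have eig: "A *v v = of_real (f v) *s v" by (simp add: Px)
  have "f v > 0"
  proof (rule ccontr)
    assume "\<not> f v > 0"
    then have "f x \<le> 0" for x using le[of x] by (smt (verit) mult_nonpos_nonneg zero_le_power2)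
    moreover have "f x \<ge> 0" for x using assms(1) by (simp add: f_def positive_op_iff)
    ultimately have "f x = 0" for x by (simp add: order_antisym)
    then have "cinner x (A *v x) = 0" for x
      using positive_op_form_eq[OF assms(1), of x] by (simp add: f_def)
    then show False using positive_op_eq_zero assms by blast
  qed
  then show thesis using that vv eig by blast
qed

text \<open>Splitting off a top eigenvector strictly enlarges the kernel, so the induction terminates.\<close>

lemma positive_op_sqrt_exists:
  fixes A :: "complex^'n^'n"
  assumes "positive_op A"
  shows "\<exists>B. positive_op B \<and> B ** B = A"
  using assms
proof (induction "DIM(complex^'n) - dim {x. A *v x = 0}" arbitrary: A rule: less_induct)
  case less
  show ?case
  proof (cases "A = 0")
    case True
    then show ?thesis using positive_op_zero by (intro exI[of _ 0]) simp
  next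
    case False
    obtain v and r :: real where v: "cinner v v = 1" and r: "r > 0"
      and eig: "A *v v = of_real r *s v"
      using positive_op_top_eigenvector[OF less.prems False] .
    have vA: "cinner v (A *v x) = of_real r * cinner v x" for x
      using positive_op_adjoint[OF less.prems, of v x] by (simp add: eig cinner_simps)
    define A' where "A' = A - mscale (of_real r) (rank_one v)"
    have A'x: "A' *v x = A *v x - of_real r *s (cinner v x *s v)" for x
      by (simp add: A'_def matrix_vector_mult_diff_rdistrib mscale_mult_vec rank_one_mult_vec)
    have pos: "positive_op A'"
    proof -
      \<comment> \<open>The form of \<open>A'\<close> at \<open>x\<close> is that of
        \<open>A\<close> at the component of \<open>x\<close> orthogonal to
        \<open>v\<close>.\<close>
      have "cinner x (A' *v x) = cinner (x - cinner v x *s v) (A *v (x - cinner v x *s v))" for x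
        by (simp add: A'x matrix_vector_mult_diff_distrib vector_scalar_commute eig cinner_simps
            vA v cnj_cinner algebra_simps)
      then show ?thesis using less.prems by (simp add: positive_op_def)
    qed
    have A'v: "A' *v v = 0" by (simp add: A'x eig v)
    \<comment> \<open>\<open>dim\<close> and \<open>DIM\<close> count real dimensions, so the
      kernels are treated as real subspaces.\<close>
    have subspace: "subspace {x. M *v x = 0}" for M :: "complex^'n^'n"
    proof -
      have "M *v (c *\<^sub>R x) = of_real c *s (M *v x)" for c x
        by (simp add: vec_eq_iff matrix_vector_mult_def sum_distrib_left
            scaleR_conv_of_real[where 'a = complex] mult_ac)
      then show ?thesis by (auto simp: subspace_def matrix_vector_right_distrib)
    qed
    have "cinner v x = 0" if "A *v x = 0" for x
      using vA[of x] that r by simp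
    then have "{x. A *v x = 0} \<subseteq> {x. A' *v x = 0}" by (auto simp: A'x)
    moreover have "v \<notin> {x. A *v x = 0}" using eig r v by auto
    ultimately have "{x. A *v x = 0} \<subset> {x. A' *v x = 0}" using A'v by auto
    then have "dim {x. A *v x = 0} < dim {x. A' *v x = 0}"
      by (intro dim_psubset) (simp add: span_eq_iff[THEN iffD2, OF subspace])
    moreover have "dim {x. A' *v x = 0} \<le> DIM(complex^'n)" by (rule dim_subset_UNIV)
    ultimately have "DIM(complex^'n) - dim {x. A' *v x = 0} < DIM(complex^'n) - dim {x. A *v x = 0}"
      by linarith
    from less.hyps[OF this pos] obtain C where C: "positive_op C" "C ** C = A'" by blast
    have CC: "C *v (C *v x) = A' *v x" for x by (simp add: matrix_vector_mul_assoc C)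
    \<comment> \<open>Since \<open>A'\<close> kills \<open>v\<close>, so does its root
      \<open>C\<close>; hence the cross terms in the square of \<open>B\<close> below
      vanish.\<close>
    have "cinner (C *v v) (C *v v) = cinner v (C *v (C *v v))"
      by (simp add: positive_op_adjoint[OF C(1)])
    then have Cv: "C *v v = 0" by (simp add: CC A'v cinner_self)
    have vC: "cinner v (C *v x) = 0" for x
      by (simp add: positive_op_adjoint[OF C(1)] Cv)
    define B where "B = C + mscale (of_real (sqrt r)) (rank_one v)"
    have Bx: "B *v x = C *v x + of_real (sqrt r) *s (cinner v x *s v)" for x
      by (simp add: B_def matrix_vector_mult_add_rdistrib mscale_mult_vec rank_one_mult_vec)
    have "positive_op B"
    proof -
      have "cinner x (B *v x) = cinner x (C *v x) + of_real (sqrt r * (cmod (cinner v x))\<^sup>2)" for x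
        by (simp add: Bx cinner_simps complex_norm_square cnj_cinner del: of_real_power)
      then show ?thesis using C(1) r by (simp add: positive_op_iff)
    qed
    moreover have "B ** B = A"
    unfolding matrix_eq
    proof
      fix x
      have "of_real (sqrt r) * (of_real (sqrt r) * z) = (of_real r * z :: complex)" for z
        using r by (simp flip: mult.assoc of_real_mult)
      then show "(B ** B) *v x = A *v x"
        by (simp add: Bx matrix_vector_right_distrib vector_scalar_commute Cv CC A'x cinner_simps
            vC v flip: matrix_vector_mul_assoc)
    qed
    ultimately show ?thesis by blast
  qed
qed

section \<open>Uniqueness of square roots\<close>

text \<open>Writes tr(DBD) for self-adjoint \<open>D\<close> as a sum of values of the form of
  \<open>B\<close>, so that positivity of \<open>B\<close> bounds every summand below by 0.\<close>

lemma cinner_column_matrix: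
  assumes "\<And>i j. cnj (D $ i $ j) = D $ j $ i"
  shows "(D ** B ** D) $ i $ i = cinner (column i D) (B *v column i D)"
  unfolding cinner_matrix
  by (subst sum.swap) (simp add: assms matrix_matrix_mult_def column_def sum_distrib_right)

text \<open>For \<open>D = B - C\<close> one has \<open>BD + DC = B\<^sup>2 - C\<^sup>2 = 0\<close>, so \<open>tr(DBD) + tr(DCD) = 0\<close>; both traces are
  nonnegative, which forces \<open>BD = CD = 0\<close> and hence \<open>D\<^sup>2 = 0\<close>.\<close>

lemma positive_op_sqrt_unique:
  fixes B C :: "complex^'n^'n"
  assumes B: "positive_op B" and C: "positive_op C" and eq: "B ** B = C ** C"
  shows "B = C"
proof -
  define D where "D = B - C"
  have D: "cnj (D $ i $ j) = D $ j $ i" for i j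
    using positive_op_cnj_entry[OF B] positive_op_cnj_entry[OF C] by (simp add: D_def)
  have "B ** D + D ** C = 0"
    by (simp add: D_def eq matrix_diff_ldistrib matrix_diff_rdistrib)
  then have "trace (D ** (B ** D) + D ** (D ** C)) = 0"
    by (simp flip: matrix_add_ldistrib add: trace_def)
  then have tr: "trace (D ** B ** D) + trace (D ** C ** D) = 0"
    by (simp add: trace_add matrix_mul_assoc trace_mul_sym[of "D ** C"])
  have nonneg: "0 \<le> Re (cinner (column i D) (B *v column i D))"
    "0 \<le> Re (cinner (column i D) (C *v column i D))" for i
    using B C by (auto simp: positive_op_iff)
  have "(\<Sum>i\<in>UNIV. Re (cinner (column i D) (B *v column i D))
      + Re (cinner (column i D) (C *v column i D))) = 0"
    using arg_cong[OF tr, of Re] by (simp add: trace_def cinner_column_matrix[OF D] sum.distrib)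
  then have "Re (cinner (column i D) (B *v column i D))
      + Re (cinner (column i D) (C *v column i D)) = 0" for i
    by (subst (asm) sum_nonneg_eq_0_iff) (auto intro: add_nonneg_nonneg nonneg)
  then have "Re (cinner (column i D) (B *v column i D)) = 0"
    and "Re (cinner (column i D) (C *v column i D)) = 0" for i
    using nonneg[of i] by (smt (verit))+
  then have "cinner (column i D) (B *v column i D) = 0"
    and "cinner (column i D) (C *v column i D) = 0" for i
    using B C by (simp_all add: positive_op_iff complex_eq_iff)
  then have "B *v column i D = 0" and "C *v column i D = 0" for i
    using positive_op_form_zero B C by blast+
  then have "D *v column i D = 0" for i
    by (simp add: D_def matrix_vector_mult_diff_rdistrib)
  \<comment> \<open>As \<open>D\<close> is self-adjoint, this entry is the squared norm of column
    \<open>i\<close>.\<close>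
  then have "(D *v column i D) $ i = 0" for i by simp
  then have "cinner (column i D) (column i D) = 0" for i
    by (simp add: cinner_def matrix_vector_mult_def column_def D)
  then have "column i D = 0" for i by (simp add: cinner_self)
  then have "D = 0" by (simp add: vec_eq_iff column_def)
  then show ?thesis by (simp add: D_def)
qed

section \<open>Evaluating \<open>op_sqrt\<close>, in particular on inverses\<close>

lemma op_sqrt_eqI:
  assumes "positive_op B" and "B ** B = A"
  shows "op_sqrt A = B"
  unfolding op_sqrt_def using assms positive_op_sqrt_unique by (intro the_equality) auto

lemma
  assumes "positive_op A"
  shows positive_op_sqrt: "positive_op (op_sqrt A)"
    and op_sqrt_square: "op_sqrt A ** op_sqrt A = A"
  using positive_op_sqrt_exists[OF assms] by (metis op_sqrt_eqI)+

lemma op_sqrt_mat_1: "op_sqrt (mat 1) = mat 1"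
  by (rule op_sqrt_eqI) (simp_all add: positive_op_mat_1)

text \<open>The inverse of \<open>op_sqrt A\<close> is positive and squares to
  \<open>matrix_inv A\<close>, so by uniqueness it is the root of
  \<open>matrix_inv A\<close>.\<close>

lemma
  assumes "positive_op A" and "invertible A"
  shows op_sqrt_matrix_inv_left: "op_sqrt (matrix_inv A) ** op_sqrt A = mat 1"
    and op_sqrt_matrix_inv_right: "op_sqrt A ** op_sqrt (matrix_inv A) = mat 1"
proof -
  let ?S = "op_sqrt A"
  have "det A \<noteq> 0" using assms(2) by (simp add: invertible_det_nz)
  then have "det ?S \<noteq> 0"
    using det_mul[of ?S ?S] by (auto simp: op_sqrt_square[OF assms(1)])
  then have inv: "invertible ?S" by (simp add: invertible_det_nz)
  let ?W = "matrix_inv ?S"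
  note W = matrix_inv_left[OF inv] matrix_inv_right[OF inv]
  have "positive_op ?W"
    using positive_op_right_inverse positive_op_sqrt[OF assms(1)] W(2) .
  moreover have "?W ** ?W = matrix_inv A"
  proof -
    have "(?W ** ?W) ** A = (?W ** ?W) ** (?S ** ?S)" by (simp add: op_sqrt_square[OF assms(1)])
    also have "\<dots> = ?W ** (?W ** ?S) ** ?S" by (simp only: matrix_mul_assoc)
    finally have "(?W ** ?W) ** A = mat 1" by (simp add: W)
    then have "(?W ** ?W) ** (A ** matrix_inv A) = matrix_inv A" by (simp add: matrix_mul_assoc)
    then show ?thesis by (simp add: matrix_inv_right[OF assms(2)])
  qed
  ultimately have "op_sqrt (matrix_inv A) = ?W" by (rule op_sqrt_eqI)
  then show "op_sqrt (matrix_inv A) ** ?S = mat 1" and "?S ** op_sqrt (matrix_inv A) = mat 1"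
    by (simp_all add: W)
qed

section \<open>Tensor products and marginals\<close>

lemma sum_UNIV_prod: "(\<Sum>r\<in>UNIV. f r) = (\<Sum>i\<in>UNIV. \<Sum>k\<in>UNIV. f (i, k))"
  by (simp add: sum.cartesian_product)

lemma sum_if_const: "(\<Sum>k\<in>A. if P then f k else 0) = (if P then \<Sum>k\<in>A. f k else 0)"
  by simp

text \<open>A partial trace puts the traced-out index outermost; moved innermost, it can be absorbed
  into a matrix product.\<close>

lemma sum_rotate:
  "(\<Sum>i\<in>A. \<Sum>b\<in>B. \<Sum>a\<in>C. f i b a) = (\<Sum>b\<in>B. \<Sum>a\<in>C. \<Sum>i\<in>A. f i b a)"
  unfolding sum.swap[of _ B A] by (intro sum.cong refl sum.swap)

lemma tensor_op_mult: "tensor_op A B ** tensor_op C D = tensor_op (A ** C) (B ** D)"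
  by (simp add: vec_eq_iff tensor_op_def matrix_matrix_mult_def sum_UNIV_prod sum_product mult_ac)

text \<open>The tensor product is the square of the self-adjoint operator formed from the two
  roots.\<close>

lemma positive_op_tensor:
  assumes "positive_op A" and "positive_op B"
  shows "positive_op (tensor_op A B)"
proof -
  have "positive_op (tensor_op (op_sqrt A) (op_sqrt B) ** tensor_op (op_sqrt A) (op_sqrt B))"
    using assms
    by (intro positive_op_square) (simp add: tensor_op_def positive_op_cnj_entry positive_op_sqrt)
  then show ?thesis using assms by (simp add: tensor_op_mult op_sqrt_square)
qed

lemma op_sqrt_tensor:
  assumes "positive_op A" and "positive_op B"
  shows "op_sqrt (tensor_op A B) = tensor_op (op_sqrt A) (op_sqrt B)"
  using assms
  by (intro op_sqrt_eqI) (simp_all add: positive_op_tensor positive_op_sqrt tensor_op_mult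
      op_sqrt_square)

lemma positive_op_marg1:
  fixes \<tau> :: "complex^('n::finite \<times> 'm::finite)^('n \<times> 'm)"
  assumes "positive_op \<tau>"
  shows "positive_op (marg1 \<tau>)"
proof -
  \<comment> \<open>\<open>e x k\<close> is the product vector of \<open>x\<close> with the basis
    vector at \<open>k\<close>. Summing the form of \<tau> over these vectors gives the form of the
    marginal at \<open>x\<close>.\<close>
  define e :: "complex^'n \<Rightarrow> 'm \<Rightarrow> complex^('n \<times> 'm)"
    where "e x k = (\<chi> r. if snd r = k then x $ fst r else 0)" for x k
  have "cinner (e x k) (\<tau> *v e x k)
      = (\<Sum>i\<in>UNIV. \<Sum>j\<in>UNIV. cnj (x $ i) * \<tau> $ (i, k) $ (j, k) * x $ j)" for x k
  proof -
    have "cnj (e x k $ (i, a)) * \<tau> $ (i, a) $ (j, b) * e x k $ (j, b)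
        = (if a = k then if b = k then cnj (x $ i) * \<tau> $ (i, k) $ (j, k) * x $ j else 0 else 0)"
      for i a j b
      by (simp add: e_def)
    then show ?thesis by (simp add: cinner_matrix sum_UNIV_prod sum_if_const)
  qed
  then have "(\<Sum>k\<in>UNIV. cinner (e x k) (\<tau> *v e x k))
      = (\<Sum>i\<in>UNIV. \<Sum>j\<in>UNIV. \<Sum>k\<in>UNIV. cnj (x $ i) * \<tau> $ (i, k) $ (j, k) * x $ j)" for x
    by (simp only:) (rule sum_rotate)
  then have "cinner x (marg1 \<tau> *v x) = (\<Sum>k\<in>UNIV. cinner (e x k) (\<tau> *v e x k))" for x
    by (simp add: cinner_matrix marg1_def sum_distrib_left sum_distrib_right)
  then show ?thesis using assms by (simp add: positive_op_iff sum_nonneg)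
qed

lemma positive_op_proj:
  assumes "positive_op \<tau>"
  shows "positive_op (proj \<tau>)"
  using assms by (simp add: proj_def positive_op_transpose positive_op_marg1)

text \<open>The entry \<open>(i, j)\<close> is \<open>cnj \<langle>ik|\<tau>|jl\<rangle>\<close> when \<open>\<tau>\<close> is self-adjoint; the conjugate-free form makes
  the contraction lemmas hold for arbitrary \<open>\<tau>\<close>.\<close>

definition choi_block ::
    "complex^('n::finite \<times> 'm::finite)^('n \<times> 'm) \<Rightarrow> 'm \<Rightarrow> 'm \<Rightarrow> complex^'n^'n" where
  "choi_block \<tau> k l = (\<chi> i j. \<tau> $ (j, l) $ (i, k))"

lemma ketbra_sandwich: "(A ** ketbra i j ** B) $ a $ b = A $ a $ i * B $ j $ b"
proof -
  have "(A ** ketbra i j) $ a $ c = (if c = j then A $ a $ i else 0)" for c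
    by (cases "c = j") (simp_all add: matrix_matrix_mult_def ketbra_def if_distrib cong: if_cong)
  then show ?thesis
    by (simp add: matrix_matrix_mult_def[of "A ** ketbra i j"] if_distrib[of "\<lambda>x. x * _"]
        cong: if_cong)
qed

text \<open>Self-adjointness of \<tau> trades the conjugated entries for swapped indices, and the
  sum over \<open>ketbra i j\<close> reassembles the block between the roots.\<close>

lemma extr_eq:
  assumes "positive_op \<tau>"
  shows "extr \<tau> k l = op_sqrt (matrix_inv (proj \<tau>)) ** choi_block \<tau> k l
    ** op_sqrt (matrix_inv (proj \<tau>))"
proof -
  let ?W = "op_sqrt (matrix_inv (proj \<tau>))"
  have "extr \<tau> k l $ a $ b = (?W ** choi_block \<tau> k l ** ?W) $ a $ b" for a b
  proof -
    have "extr \<tau> k l $ a $ b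
        = (\<Sum>i\<in>UNIV. \<Sum>j\<in>UNIV. ?W $ a $ i * \<tau> $ (j, l) $ (i, k) * ?W $ j $ b)"
      by (simp add: extr_def mscale_def ketbra_sandwich positive_op_cnj_entry[OF assms] mult_ac)
    also have "\<dots> = (?W ** choi_block \<tau> k l ** ?W) $ a $ b"
      by (subst sum.swap) (simp add: matrix_matrix_mult_def choi_block_def sum_distrib_right)
    finally show ?thesis .
  qed
  then show ?thesis by (simp add: vec_eq_iff)
qed

section \<open>Marginals and validities as contractions with the blocks of \<tau>\<close>

lemma tensor_left_sandwich:
  "(tensor_op A (mat 1) ** \<tau> ** tensor_op B (mat 1)) $ (i, k) $ (j, l)
    = (\<Sum>b\<in>UNIV. \<Sum>a\<in>UNIV. A $ i $ a * \<tau> $ (a, k) $ (b, l) * B $ b $ j)"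
  by (simp add: matrix_matrix_mult_def tensor_op_def mat_def sum_UNIV_prod sum_distrib_right
      if_distrib if_distribR cong: if_cong)

lemma tensor_right_sandwich:
  "(tensor_op (mat 1) A ** \<tau> ** tensor_op (mat 1) B) $ (i, k) $ (j, l)
    = (\<Sum>b\<in>UNIV. \<Sum>a\<in>UNIV. A $ k $ a * \<tau> $ (i, a) $ (j, b) * B $ b $ l)"
  by (simp add: matrix_matrix_mult_def tensor_op_def mat_def sum_UNIV_prod sum_distrib_right
      sum_if_const if_distrib if_distribR cong: if_cong)

lemma trace_mult_eq: "trace (A ** B) = (\<Sum>i\<in>UNIV. \<Sum>j\<in>UNIV. A $ i $ j * B $ j $ i)"
  by (simp add: trace_def matrix_matrix_mult_def)

text \<open>Tracing out the first factor joins the outer indices of \<open>A\<close> and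
  \<open>B\<close>, so only \<open>B ** A\<close> survives; with both equal to the root of
  \<open>p\<close>, this is \<open>p\<close>. The transpose matches the swapped indices of
  \<open>choi_block\<close>.\<close>

lemma marg2_tensor_left_sandwich:
  "marg2 (tensor_op A (mat 1) ** \<tau> ** tensor_op B (mat 1)) $ k $ l
    = trace (choi_block \<tau> l k ** transpose (B ** A))"
proof -
  have "marg2 (tensor_op A (mat 1) ** \<tau> ** tensor_op B (mat 1)) $ k $ l
    = (\<Sum>i\<in>UNIV. \<Sum>b\<in>UNIV. \<Sum>a\<in>UNIV. A $ i $ a * \<tau> $ (a, k) $ (b, l) * B $ b $ i)"
    by (simp add: marg2_def tensor_left_sandwich)
  also have "\<dots> = (\<Sum>b\<in>UNIV. \<Sum>a\<in>UNIV. \<Sum>i\<in>UNIV. A $ i $ a * \<tau> $ (a, k) $ (b, l) * B $ b $ i)"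
    by (rule sum_rotate)
  also have "\<dots> = trace (choi_block \<tau> l k ** transpose (B ** A))"
    by (simp add: trace_mult_eq choi_block_def transpose_def matrix_matrix_mult_def[of B A]
        sum_distrib_left mult_ac)
  finally show ?thesis .
qed

lemma marg1_tensor_right_sandwich:
  "marg1 (tensor_op (mat 1) A ** \<tau> ** tensor_op (mat 1) B)
    = transpose (pred_trans (choi_block \<tau>) (B ** A))"
proof -
  have "marg1 (tensor_op (mat 1) A ** \<tau> ** tensor_op (mat 1) B) $ i $ j
    = transpose (pred_trans (choi_block \<tau>) (B ** A)) $ i $ j" for i j
  proof -
    have "marg1 (tensor_op (mat 1) A ** \<tau> ** tensor_op (mat 1) B) $ i $ j
      = (\<Sum>k\<in>UNIV. \<Sum>b\<in>UNIV. \<Sum>a\<in>UNIV. A $ k $ a * \<tau> $ (i, a) $ (j, b) * B $ b $ k)"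
      by (simp add: marg1_def tensor_right_sandwich)
    also have "\<dots> = (\<Sum>b\<in>UNIV. \<Sum>a\<in>UNIV. \<Sum>k\<in>UNIV. A $ k $ a * \<tau> $ (i, a) $ (j, b) * B $ b $ k)"
      by (rule sum_rotate)
    also have "\<dots> = transpose (pred_trans (choi_block \<tau>) (B ** A)) $ i $ j"
      by (simp add: pred_trans_def mscale_def transpose_def choi_block_def
          matrix_matrix_mult_def[of B A] sum_distrib_left mult_ac)
    finally show ?thesis .
  qed
  then show ?thesis by (simp add: vec_eq_iff)
qed

text \<open>Makes the normalizing factors on the two sides of the first identity agree.\<close>

lemma validity_tensor_left:
  "validity \<tau> (tensor_op p (mat 1)) = validity (proj \<tau>) (transpose p)"
proof -
  have "validity \<tau> (tensor_op p (mat 1))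
      = (\<Sum>i\<in>UNIV. \<Sum>k\<in>UNIV. \<Sum>j\<in>UNIV. \<tau> $ (i, k) $ (j, k) * p $ j $ i)"
    by (simp add: validity_def trace_mult_eq sum_UNIV_prod tensor_op_def mat_def if_distrib
        if_distribR cong: if_cong)
  also have "\<dots> = (\<Sum>j\<in>UNIV. \<Sum>i\<in>UNIV. \<Sum>k\<in>UNIV. \<tau> $ (i, k) $ (j, k) * p $ j $ i)"
    by (rule sum_rotate[symmetric])
  also have "\<dots> = validity (proj \<tau>) (transpose p)"
    by (simp add: validity_def trace_mult_eq proj_def marg1_def transpose_def sum_distrib_right)
  finally show ?thesis .
qed

lemma validity_tensor_right:
  "validity \<tau> (tensor_op (mat 1) q) = trace (pred_trans (choi_block \<tau>) q)"
proof -
  have "tensor_op (mat 1) (mat 1) = (mat 1 :: complex^('a \<times> 'b)^('a \<times> 'b))"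
    by (auto simp: vec_eq_iff tensor_op_def mat_def)
  \<comment> \<open>The case of a trivial left factor; taking the trace of the marginal recovers the
    full trace.\<close>
  then have "marg1 (\<tau> ** tensor_op (mat 1) q) = transpose (pred_trans (choi_block \<tau>) q)"
    using marg1_tensor_right_sandwich[of "mat 1" \<tau> q] by simp
  then have "trace (marg1 (\<tau> ** tensor_op (mat 1) q)) = trace (pred_trans (choi_block \<tau>) q)"
    by (simp add: trace_def transpose_def)
  then show ?thesis
    by (simp add: validity_def trace_def marg1_def sum_UNIV_prod)
qed

section \<open>Compatibility with scalars and sums\<close>

lemma matrix_mscale_left: "mscale c A ** B = mscale c (A ** B)"
  by (simp add: vec_eq_iff mscale_def matrix_matrix_mult_def sum_distrib_left mult.assoc)

lemma matrix_mscale_right: "A ** mscale c B = mscale c (A ** B)"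
  by (simp add: vec_eq_iff mscale_def matrix_matrix_mult_def sum_distrib_left mult_ac)

lemma trace_mscale: "trace (mscale c A) = c * trace A"
  by (simp add: trace_def mscale_def sum_distrib_left)

lemma marg1_mscale: "marg1 (mscale c \<tau>) = mscale c (marg1 \<tau>)"
  by (simp add: vec_eq_iff marg1_def mscale_def sum_distrib_left)

lemma marg2_mscale: "marg2 (mscale c \<tau>) = mscale c (marg2 \<tau>)"
  by (simp add: vec_eq_iff marg2_def mscale_def sum_distrib_left)

lemma transpose_mscale: "transpose (mscale c A) = mscale c (transpose A)"
  by (simp add: vec_eq_iff mscale_def transpose_def)

lemma matrix_add_rdistrib: "(A + B) ** C = A ** C + B ** (C :: complex^'n^'n)"
  by (simp add: vec_eq_iff matrix_matrix_mult_def distrib_right sum.distrib)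

lemma matrix_sum_left: "(\<Sum>i\<in>I. f i) ** B = (\<Sum>i\<in>I. f i ** (B :: complex^'n^'n))"
  by (induction I rule: infinite_finite_induct) (simp_all add: matrix_add_rdistrib)

lemma matrix_sum_right: "A ** (\<Sum>i\<in>I. f i) = (\<Sum>i\<in>I. (A :: complex^'n^'n) ** f i)"
  by (induction I rule: infinite_finite_induct) (simp_all add: matrix_add_ldistrib)

text \<open>Predicate transformation is linear in the family, so fixed outer factors can be pulled
  out; used for the roots in \<open>extr\<close>.\<close>

lemma pred_trans_sandwich:
  fixes A B :: "complex^'n^'n"
  shows
  "pred_trans (\<lambda>k l. A ** c k l ** B) q = A ** pred_trans c q ** B"
  by (simp add: pred_trans_def matrix_sum_left matrix_sum_right matrix_mscale_left
      matrix_mscale_right)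

theorem theorem6p1:
  fixes \<tau> :: "complex^('n::finite \<times> 'm::finite)^('n \<times> 'm)"
    and p :: "complex^'n^'n"
    and q :: "complex^'m^'m"
  assumes "is_state \<tau>"
    and "invertible (proj \<tau>)"
    and "is_predicate p"
    and "is_predicate q"
    and "validity \<tau> (tensor_op p (mat 1)) \<noteq> 0"
    and "validity (proj \<tau>) (transpose p) \<noteq> 0"
    and "validity \<tau> (tensor_op (mat 1) q) \<noteq> 0"
    and "validity (proj \<tau>) (pred_trans (extr \<tau>) q) \<noteq> 0"
  shows "marg2 (lower_cond \<tau> (tensor_op p (mat 1)))
           = state_trans (extr \<tau>) (upper_cond (proj \<tau>) (transpose p)) \<and>
         marg1 (lower_cond \<tau> (tensor_op (mat 1) q))
           = transpose (upper_cond (proj \<tau>) (pred_trans (extr \<tau>) q))"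
proof
  have \<tau>: "positive_op \<tau>" and p: "positive_op p" and q: "positive_op q"
    using assms by (simp_all add: is_state_def is_predicate_def loewner_le_def)
  let ?S = "op_sqrt (proj \<tau>)" and ?W = "op_sqrt (matrix_inv (proj \<tau>))"
  note R = positive_op_proj[OF \<tau>]
  have WS: "?W ** ?S = mat 1" and SW: "?S ** ?W = mat 1"
    using op_sqrt_matrix_inv_left op_sqrt_matrix_inv_right R assms(2) by auto
  show "marg2 (lower_cond \<tau> (tensor_op p (mat 1)))
      = state_trans (extr \<tau>) (upper_cond (proj \<tau>) (transpose p))"
  proof -
    have "trace (extr \<tau> l k ** (?S ** transpose p ** ?S)) = trace (choi_block \<tau> l k ** transpose p)"
      for k l
    proof -
      \<comment> \<open>One pair of roots meets directly as \<open>?W ** ?S\<close>; the outer pair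
        meets only after a cyclic shift under the trace.\<close>
      have "extr \<tau> l k ** (?S ** transpose p ** ?S)
          = ?W ** choi_block \<tau> l k ** (?W ** ?S) ** transpose p ** ?S"
        by (simp only: extr_eq[OF \<tau>] matrix_mul_assoc)
      also have "\<dots> = (?W ** (choi_block \<tau> l k ** transpose p)) ** ?S"
        by (simp add: WS matrix_mul_assoc)
      also have "trace \<dots> = trace (?S ** ?W ** (choi_block \<tau> l k ** transpose p))"
        by (subst trace_mul_sym) (simp add: matrix_mul_assoc)
      finally show ?thesis by (simp add: SW)
    qed
    then show ?thesis
      by (simp add: vec_eq_iff lower_cond_def upper_cond_def state_trans_def marg2_mscale
          op_sqrt_tensor[OF p positive_op_mat_1] op_sqrt_mat_1 marg2_tensor_left_sandwich
          op_sqrt_square[OF p] validity_tensor_left matrix_mscale_right trace_mscale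
          mscale_def[of _ "marg2 _"])
  qed
  show "marg1 (lower_cond \<tau> (tensor_op (mat 1) q))
      = transpose (upper_cond (proj \<tau>) (pred_trans (extr \<tau>) q))"
  proof -
    let ?T = "pred_trans (choi_block \<tau>) q"
    have ext: "pred_trans (extr \<tau>) q = ?W ** ?T ** ?W"
      using pred_trans_sandwich[of ?W "choi_block \<tau>" ?W q] extr_eq[OF \<tau>]
      by (simp add: pred_trans_def)
    \<comment> \<open>Here both pairs of roots are adjacent, so they cancel without a trace.\<close>
    have "?S ** (?W ** ?T ** ?W) ** ?S = (?S ** ?W) ** ?T ** (?W ** ?S)"
      by (simp only: matrix_mul_assoc)
    then have S: "?S ** (?W ** ?T ** ?W) ** ?S = ?T" by (simp add: WS SW)
    \<comment> \<open>Splitting \<open>proj \<tau>\<close> into two roots and cycling one to the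
      right reduces the normalizing factor to \<open>S\<close>.\<close>
    have "validity (proj \<tau>) (?W ** ?T ** ?W) = trace (?S ** (?S ** (?W ** ?T ** ?W)))"
      by (simp add: validity_def matrix_mul_assoc op_sqrt_square[OF R])
    also have "\<dots> = trace ?T" by (subst trace_mul_sym) (simp only: S)
    finally show ?thesis
      by (simp add: lower_cond_def upper_cond_def marg1_mscale transpose_mscale ext S
          op_sqrt_tensor[OF positive_op_mat_1 q] op_sqrt_mat_1 marg1_tensor_right_sandwich
          op_sqrt_square[OF q] validity_tensor_right)
  qed
qed

end
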